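(* Let $G=(V,E)$ be a graph that is $M$-connected in $\mathbb{R}^d$. Then $G$ is $M$-connected in $\mathbb{R}^{d'}$ for all $1\leq d'\leq d$.
   Context: For $p:V\to\mathbb{R}^k$ the rigidity matrix $R(G,p)$ is the $|E|\times k|V|$ matrix whose row for edge $uv$ has $p(u)-p(v)$ in the columns of $u$, $p(v)-p(u)$ in the columns of $v$, zeros elsewhere. The $k$-dimensional rigidity matroid $\mathcal{R}_k(G)$ on $E$ is defined by linear independence of rows of $R(G,p)$ for $p$ generic (coordinates algebraically independent over $\mathbb{Q}$). $G$ is $M$-connected in $\mathbb{R}^k$ if $\mathcal{R}_k(G)$ is connected, i.e.\ any two distinct edges lie in a common circuit of $\mathcal{R}_k(G)$. *)

theory Defs
  imports Complex_Main
begin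

definition simple_graph :: "'a set \<Rightarrow> 'a set set \<Rightarrow> bool" where
  "simple_graph V E \<longleftrightarrow> finite V \<and>
     (\<forall>e\<in>E. \<exists>u v. u \<in> V \<and> v \<in> V \<and> u \<noteq> v \<and> e = {u, v})"

text \<open>Algebraic independence over the rationals of the reals x i, i in a finite index set I:
  no nonzero rational polynomial in the variables indexed by I vanishes at x.
  A polynomial is given by a finite set M of exponent vectors (supported in I)
  and rational coefficients c.\<close>
definition alg_indep_rat :: "'b set \<Rightarrow> ('b \<Rightarrow> real) \<Rightarrow> bool" where
  "alg_indep_rat I x \<longleftrightarrow>
     (\<forall>(M :: ('b \<Rightarrow> nat) set) (c :: ('b \<Rightarrow> nat) \<Rightarrow> rat).
        finite M \<longrightarrow> (\<forall>m\<in>M. \<forall>i. i \<notin> I \<longrightarrow> m i = 0) \<longrightarrow>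
        (\<Sum>m\<in>M. of_rat (c m) * (\<Prod>i\<in>I. x i ^ m i)) = 0 \<longrightarrow>
        (\<forall>m\<in>M. c m = 0))"

definition generic :: "'a set \<Rightarrow> nat \<Rightarrow> ('a \<Rightarrow> nat \<Rightarrow> real) \<Rightarrow> bool" where
  "generic V k p \<longleftrightarrow> alg_indep_rat (V \<times> {..<k}) (\<lambda>(v, j). p v j)"

text \<open>Entry of the row of the rigidity matrix R(G,p) for edge e = {u,v} in column (w,j):
  p(u)_j - p(v)_j if w = u, p(v)_j - p(u)_j if w = v, and 0 otherwise.\<close>
definition rig_entry :: "('a \<Rightarrow> nat \<Rightarrow> real) \<Rightarrow> 'a set \<Rightarrow> 'a \<Rightarrow> nat \<Rightarrow> real" where
  "rig_entry p e w j = (if w \<in> e then (\<Sum>x\<in>e - {w}. p w j - p x j) else 0)"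

definition rows_indep :: "'a set \<Rightarrow> nat \<Rightarrow> ('a \<Rightarrow> nat \<Rightarrow> real) \<Rightarrow> 'a set set \<Rightarrow> bool" where
  "rows_indep V k p F \<longleftrightarrow>
     (\<forall>c :: 'a set \<Rightarrow> real.
        (\<forall>w\<in>V. \<forall>j<k. (\<Sum>e\<in>F. c e * rig_entry p e w j) = 0) \<longrightarrow> (\<forall>e\<in>F. c e = 0))"

definition rig_indep :: "'a set \<Rightarrow> nat \<Rightarrow> 'a set set \<Rightarrow> bool" where
  "rig_indep V k F \<longleftrightarrow> (\<exists>p. generic V k p \<and> rows_indep V k p F)"

definition rig_circuit :: "'a set \<Rightarrow> 'a set set \<Rightarrow> nat \<Rightarrow> 'a set set \<Rightarrow> bool" where
  "rig_circuit V E k C \<longleftrightarrow> C \<subseteq> E \<and> \<not> rig_indep V k C \<and>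
     (\<forall>D. D \<subset> C \<longrightarrow> rig_indep V k D)"

definition M_connected :: "'a set \<Rightarrow> 'a set set \<Rightarrow> nat \<Rightarrow> bool" where
  "M_connected V E k \<longleftrightarrow>
     (\<forall>e\<in>E. \<forall>f\<in>E. e \<noteq> f \<longrightarrow> (\<exists>C. rig_circuit V E k C \<and> e \<in> C \<and> f \<in> C))"

end

theory Submission
  imports Defs
    "HOL-Library.Function_Algebras"
    "HOL-Library.Indicator_Function"
    "HOL-Combinatorics.Transposition"
begin

text \<open>
  A stress (row dependency of the rigidity matrix) of a framework p in R^d satisfies one system
  of equations per coordinate. Hence the space of stresses of p is the intersection, over all
  selections of d' of the d coordinates, of the stress spaces of the projected frameworks. If p
  is generic then so are these projections, and they all define the same matroid: Gaussian
  elimination keeps the entries polynomial, and a pivot that is nonzero at some point is nonzero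
  at every generic one. Each component of that matroid separates every projected stress space,
  in the sense that setting a stress to zero outside it yields a stress. So it separates the
  intersection too, and a circuit in R^d that meets it lies inside it.
\<close>

section \<open>Circuits of spaces of functions\<close>

definition scale_fun :: "'k::field \<Rightarrow> ('e \<Rightarrow> 'k) \<Rightarrow> 'e \<Rightarrow> 'k" where
  "scale_fun a c = (\<lambda>x. a * c x)"

lemma scale_fun_apply [simp]: "scale_fun a c x = a * c x"
  by (simp add: scale_fun_def)

interpretation fun_space: vector_space scale_fun
  by standard (auto simp: fun_eq_iff algebra_simps)

definition supp :: "('e \<Rightarrow> 'k::zero) \<Rightarrow> 'e set" where
  "supp c = {x. c x \<noteq> 0}"

definition dependent :: "('e \<Rightarrow> 'k::zero) set \<Rightarrow> 'e set \<Rightarrow> bool" where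
  "dependent S F \<longleftrightarrow> (\<exists>c\<in>S. c \<noteq> 0 \<and> supp c \<subseteq> F)"

definition circuit :: "('e \<Rightarrow> 'k::zero) set \<Rightarrow> 'e set \<Rightarrow> bool" where
  "circuit S C \<longleftrightarrow> dependent S C \<and> (\<forall>D. D \<subset> C \<longrightarrow> \<not> dependent S D)"

definition component :: "('e \<Rightarrow> 'k::zero) set \<Rightarrow> 'e \<Rightarrow> 'e set" where
  "component S e = {f. f = e \<or> (\<exists>C. circuit S C \<and> e \<in> C \<and> f \<in> C)}"

definition separator :: "('e \<Rightarrow> 'k::field) set \<Rightarrow> 'e set \<Rightarrow> bool" where
  "separator S X \<longleftrightarrow> (\<forall>c\<in>S. indicator X * c \<in> S)"

definition matroid_connected :: "('e \<Rightarrow> 'k::zero) set \<Rightarrow> 'e set \<Rightarrow> bool" where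
  "matroid_connected S E \<longleftrightarrow>
     (\<forall>e\<in>E. \<forall>f\<in>E. e \<noteq> f \<longrightarrow> (\<exists>C. circuit S C \<and> e \<in> C \<and> f \<in> C))"

lemma supp_empty_iff [simp]: "supp c = {} \<longleftrightarrow> c = 0"
  by (auto simp: supp_def fun_eq_iff)

lemma supp_indicator_mult: "supp (indicator X * c) = X \<inter> supp c"
  for c :: "'e \<Rightarrow> 'k::field"
  by (auto simp: supp_def indicator_def)

lemma indicator_mult_supp_subset: "supp c \<subseteq> X \<Longrightarrow> indicator X * c = c"
  for c :: "'e \<Rightarrow> 'k::field"
  by (auto simp: supp_def indicator_def fun_eq_iff)

lemma circuit_vector:
  assumes "circuit S C"
  obtains c where "c \<in> S" "supp c = C"
  using assms unfolding circuit_def dependent_def by (metis psubsetI subset_refl)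

lemma circuit_subset_eq: "circuit S C \<Longrightarrow> circuit S D \<Longrightarrow> C \<subseteq> D \<Longrightarrow> C = D"
  unfolding circuit_def by blast

lemma circuit_subset_separator:
  assumes "circuit S C" "separator S X" "C \<inter> X \<noteq> {}"
  shows "C \<subseteq> X"
proof (rule ccontr)
  assume "\<not> C \<subseteq> X"
  then have "X \<inter> C \<subset> C" by blast
  obtain c where "c \<in> S" and supp_c: "supp c = C"
    using assms(1) by (rule circuit_vector)
  have supp_restrict: "supp (indicator X * c) = X \<inter> C"
    by (simp add: supp_indicator_mult supp_c)
  moreover have "indicator X * c \<in> S"
    using assms(2) \<open>c \<in> S\<close> unfolding separator_def by blast
  moreover have "indicator X * c \<noteq> 0"
    using assms(3) supp_restrict supp_empty_iff[of "indicator X * c"] by blast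
  ultimately have "dependent S (X \<inter> C)"
    unfolding dependent_def by blast
  with \<open>X \<inter> C \<subset> C\<close> assms(1) show False
    unfolding circuit_def by blast
qed

locale finite_support_space =
  fixes S :: "('e \<Rightarrow> 'k::field) set"
  assumes subspace: "fun_space.subspace S"
    and finite_supp: "c \<in> S \<Longrightarrow> finite (supp c)"
begin

lemma finite_circuit: "circuit S C \<Longrightarrow> finite C"
  by (metis circuit_vector finite_supp)

lemma eliminate_coordinate:
  assumes "c \<in> S" "c' \<in> S" "h \<in> supp c'"
  obtains a where "c - scale_fun a c' \<in> S"
    "supp (c - scale_fun a c') \<subseteq> supp c \<union> supp c' - {h}"
    "supp c - supp c' \<subseteq> supp (c - scale_fun a c')"
proof
  let ?b = "c - scale_fun (c h / c' h) c'"
  show "?b \<in> S"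
    using assms by (intro fun_space.subspace_diff fun_space.subspace_scale subspace)
qed (use assms(3) in \<open>auto simp: supp_def\<close>)

lemma circuit_in_supp:
  assumes "c \<in> S" "e \<in> supp c"
  shows "\<exists>C. circuit S C \<and> e \<in> C \<and> C \<subseteq> supp c"
  using finite_supp[OF assms(1)] assms
proof (induction "supp c" arbitrary: c rule: finite_psubset_induct)
  case psubset
  have smaller: ?case if "b \<in> S" "e \<in> supp b" "supp b \<subset> supp c" for b
    using psubset.hyps(2)[OF that(3,1,2)] that(3) by blast
  show ?case
  proof (cases "circuit S (supp c)")
    case True
    with psubset.prems show ?thesis by blast
  next
    case False
    have "dependent S (supp c)"
      using psubset.prems supp_empty_iff unfolding dependent_def by fastforce
    with False obtain c' where "c' \<in> S" "c' \<noteq> 0" and proper: "supp c' \<subset> supp c"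
      unfolding circuit_def dependent_def by (meson order_le_less_trans)
    then obtain h where "h \<in> supp c'"
      using supp_empty_iff by blast
    with psubset.prems(1) \<open>c' \<in> S\<close> obtain a where "c - scale_fun a c' \<in> S"
      "supp (c - scale_fun a c') \<subseteq> supp c \<union> supp c' - {h}"
      "supp c - supp c' \<subseteq> supp (c - scale_fun a c')"
      by (rule eliminate_coordinate)
    then show ?thesis
      using smaller[of c'] smaller[of "c - scale_fun a c'"] psubset.prems(2)
        \<open>c' \<in> S\<close> \<open>h \<in> supp c'\<close> proper by blast
  qed
qed

lemma strong_circuit_elimination:
  assumes "circuit S C1" "circuit S C2" "g \<in> C1 \<inter> C2" "e \<in> C1 - C2"
  shows "\<exists>C. circuit S C \<and> e \<in> C \<and> C \<subseteq> C1 \<union> C2 - {g}"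
proof -
  obtain c1 where "c1 \<in> S" and supp_c1: "supp c1 = C1"
    using assms(1) by (rule circuit_vector)
  obtain c2 where "c2 \<in> S" and supp_c2: "supp c2 = C2"
    using assms(2) by (rule circuit_vector)
  have "g \<in> supp c2" using assms(3) supp_c2 by simp
  with \<open>c1 \<in> S\<close> \<open>c2 \<in> S\<close> obtain a where combination: "c1 - scale_fun a c2 \<in> S"
    "supp (c1 - scale_fun a c2) \<subseteq> supp c1 \<union> supp c2 - {g}"
    "supp c1 - supp c2 \<subseteq> supp (c1 - scale_fun a c2)"
    by (rule eliminate_coordinate)
  have "e \<in> supp (c1 - scale_fun a c2)"
    using combination(3) assms(4) supp_c1 supp_c2 by blast
  with combination(1) obtain C where "circuit S C" "e \<in> C" "C \<subseteq> supp (c1 - scale_fun a c2)"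
    using circuit_in_supp by blast
  with combination(2) supp_c1 supp_c2 show ?thesis by (metis order_trans)
qed

lemma common_circuit_of_meeting:
  assumes "circuit S C1" "circuit S C2" "e \<in> C1" "f \<in> C2" "C1 \<inter> C2 \<noteq> {}"
  shows "\<exists>C. circuit S C \<and> e \<in> C \<and> f \<in> C"
  using finite_UnI[OF finite_circuit[OF assms(1)] finite_circuit[OF assms(2)]] assms
proof (induction "C1 \<union> C2" arbitrary: C1 C2 rule: finite_psubset_induct)
  case psubset
  note circuits = psubset.prems(1,2)
  have smaller: ?case
    if "circuit S D1" "circuit S D2" "e \<in> D1" "f \<in> D2" "D1 \<inter> D2 \<noteq> {}" "D1 \<union> D2 \<subset> C1 \<union> C2"
    for D1 D2
    using psubset.hyps(2)[OF that(6,1-5)] .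
  show ?case
  proof (cases "e \<in> C2 \<or> f \<in> C1")
    case True
    with psubset.prems show ?thesis by blast
  next
    case False
    obtain g where g: "g \<in> C1 \<inter> C2" using psubset.prems(5) by blast
    obtain C3 where C3: "circuit S C3" "e \<in> C3" "C3 \<subseteq> C1 \<union> C2 - {g}"
      using strong_circuit_elimination[OF circuits g, of e] psubset.prems False by blast
    obtain C4 where C4: "circuit S C4" "f \<in> C4" "C4 \<subseteq> C1 \<union> C2 - {g}"
      using strong_circuit_elimination[OF circuits(2,1), of g f] psubset.prems False g by blast
    have C3_meets: "C3 \<inter> (C2 - C1) \<noteq> {}"
      using circuit_subset_eq[OF C3(1) circuits(1)] C3(3) g by blast
    have C4_meets: "C4 \<inter> (C1 - C2) \<noteq> {}"
      using circuit_subset_eq[OF C4(1) circuits(2)] C4(3) g by blast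
    show ?thesis
    proof (cases "C2 - C1 \<subseteq> C4")
      case True
      then have "C3 \<inter> C4 \<noteq> {}" using C3_meets by blast
      moreover have "C3 \<union> C4 \<subset> C1 \<union> C2" using C3(3) C4(3) g by blast
      ultimately show ?thesis using smaller C3 C4 by blast
    next
      case False
      then have "C1 \<union> C4 \<subset> C1 \<union> C2" using C4(3) by blast
      then show ?thesis using smaller[of C1 C4] psubset.prems C4 C4_meets by blast
    qed
  qed
qed

lemma circuit_subset_component:
  assumes "circuit S C" "C \<inter> component S e \<noteq> {}"
  shows "C \<subseteq> component S e"
proof
  fix g assume "g \<in> C"
  from assms(2) consider (same) "e \<in> C"
    | (linked) f C' where "f \<in> C" "circuit S C'" "e \<in> C'" "f \<in> C'"
    by (auto simp: component_def)
  then show "g \<in> component S e"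
  proof cases
    case same
    with assms(1) \<open>g \<in> C\<close> show ?thesis by (auto simp: component_def)
  next
    case linked
    then show ?thesis
      using common_circuit_of_meeting[of C' C e g] assms(1) \<open>g \<in> C\<close>
      by (auto simp: component_def)
  qed
qed

lemma subset_span_circuit_vectors: "S \<subseteq> fun_space.span {c \<in> S. circuit S (supp c)}"
proof
  let ?B = "{c \<in> S. circuit S (supp c)}"
  fix c assume "c \<in> S"
  with finite_supp[OF \<open>c \<in> S\<close>] show "c \<in> fun_space.span ?B"
  proof (induction "supp c" arbitrary: c rule: finite_psubset_induct)
    case psubset
    show ?case
    proof (cases "c = 0")
      case True
      then show ?thesis by (simp add: fun_space.span_zero)
    next
      case False
      then obtain h where "h \<in> supp c" using supp_empty_iff by blast
      then obtain C where "circuit S C" "h \<in> C" "C \<subseteq> supp c"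
        using circuit_in_supp[OF psubset.prems] by blast
      obtain c' where "c' \<in> S" and supp_c': "supp c' = C"
        using \<open>circuit S C\<close> by (rule circuit_vector)
      have "h \<in> supp c'" using \<open>h \<in> C\<close> supp_c' by simp
      with psubset.prems \<open>c' \<in> S\<close> obtain a where "c - scale_fun a c' \<in> S"
        "supp (c - scale_fun a c') \<subseteq> supp c \<union> supp c' - {h}"
        by (rule eliminate_coordinate)
      moreover from this(2) have "supp (c - scale_fun a c') \<subset> supp c"
        using \<open>h \<in> supp c\<close> \<open>C \<subseteq> supp c\<close> supp_c' by blast
      ultimately have "c - scale_fun a c' \<in> fun_space.span ?B"
        using psubset.hyps(2) by blast
      moreover have "scale_fun a c' \<in> fun_space.span ?B"
        using \<open>c' \<in> S\<close> \<open>circuit S C\<close> supp_c'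
        by (intro fun_space.span_scale fun_space.span_base) simp
      ultimately show ?thesis
        using fun_space.span_add by fastforce
    qed
  qed
qed

lemma separator_if_circuits:
  assumes "\<And>C. circuit S C \<Longrightarrow> C \<inter> X \<noteq> {} \<Longrightarrow> C \<subseteq> X"
  shows "separator S X"
proof -
  have "indicator X * c \<in> S" if "c \<in> S" "circuit S (supp c)" for c
  proof (cases "supp c \<inter> X = {}")
    case True
    then have "indicator X * c = 0"
      using supp_indicator_mult[of X c] by (simp add: Int_commute)
    then show ?thesis by (simp add: fun_space.subspace_0[OF subspace])
  next
    case False
    with assms that show ?thesis by (simp add: indicator_mult_supp_subset)
  qed
  then have "{c \<in> S. circuit S (supp c)} \<subseteq> {c. indicator X * c \<in> S}"
    by blast
  moreover have "fun_space.subspace {c. indicator X * c \<in> S}"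
  proof (rule fun_space.subspaceI)
    have "indicator X * scale_fun a c = scale_fun a (indicator X * c)" for a and c :: "'e \<Rightarrow> 'k"
      by (simp add: fun_eq_iff)
    then show "scale_fun a c \<in> {c. indicator X * c \<in> S}"
      if "c \<in> {c. indicator X * c \<in> S}" for a c
      using that by (simp add: fun_space.subspace_scale[OF subspace])
  qed (simp_all add: distrib_left fun_space.subspace_0[OF subspace]
      fun_space.subspace_add[OF subspace])
  ultimately have "fun_space.span {c \<in> S. circuit S (supp c)} \<subseteq> {c. indicator X * c \<in> S}"
    by (rule fun_space.span_minimal)
  then show ?thesis
    using subset_span_circuit_vectors unfolding separator_def by blast
qed

lemma separator_component: "separator S (component S e)"
  using circuit_subset_component by (rule separator_if_circuits)

end

lemma matroid_connected_if_Inter: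
  assumes "\<And>i. i \<in> I \<Longrightarrow> finite_support_space (S i)"
    and same_circuits: "\<And>i j C. i \<in> I \<Longrightarrow> j \<in> I \<Longrightarrow> circuit (S i) C \<longleftrightarrow> circuit (S j) C"
    and connected: "matroid_connected (\<Inter>i\<in>I. S i) E" and "i \<in> I"
  shows "matroid_connected (S i) E"
  unfolding matroid_connected_def
proof (intro ballI impI)
  fix e f assume "e \<in> E" "f \<in> E" "e \<noteq> f"
  then obtain C where C: "circuit (\<Inter>i\<in>I. S i) C" "e \<in> C" "f \<in> C"
    using connected unfolding matroid_connected_def by blast
  let ?X = "component (S i) e"
  have "separator (S j) ?X" if "j \<in> I" for j
  proof -
    interpret finite_support_space "S j" using assms(1) that .
    have "?X = component (S j) e"
      using same_circuits[OF \<open>i \<in> I\<close> that] by (simp add: component_def)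
    then show ?thesis using separator_component by simp
  qed
  then have "separator (\<Inter>i\<in>I. S i) ?X"
    unfolding separator_def by blast
  moreover have "e \<in> ?X" by (simp add: component_def)
  ultimately have "C \<subseteq> ?X"
    using circuit_subset_separator[OF C(1)] C(2) by blast
  then show "\<exists>C. circuit (S i) C \<and> e \<in> C \<and> f \<in> C"
    using C(3) \<open>e \<noteq> f\<close> by (auto simp: component_def)
qed

section \<open>Rational polynomials at algebraically independent points\<close>

definition exponents :: "'b set \<Rightarrow> ('b \<Rightarrow> nat) set" where
  "exponents I = {m. \<forall>i. i \<notin> I \<longrightarrow> m i = 0}"

definition monomial :: "'b set \<Rightarrow> ('b \<Rightarrow> nat) \<Rightarrow> ('b \<Rightarrow> 'k::comm_semiring_1) \<Rightarrow> 'k" where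
  "monomial I m x = (\<Prod>i\<in>I. x i ^ m i)"

definition rat_poly_fun :: "'b set \<Rightarrow> (('b \<Rightarrow> 'k::field_char_0) \<Rightarrow> 'k) \<Rightarrow> bool" where
  "rat_poly_fun I f \<longleftrightarrow> (\<exists>M c. finite M \<and> M \<subseteq> exponents I \<and>
     f = (\<lambda>x. \<Sum>m\<in>M. of_rat (c m) * monomial I m x))"

lemma alg_indep_rat_iff:
  "alg_indep_rat I x \<longleftrightarrow>
    (\<forall>M c. finite M \<longrightarrow> M \<subseteq> exponents I \<longrightarrow> (\<Sum>m\<in>M. of_rat (c m) * monomial I m x) = 0 \<longrightarrow>
      (\<forall>m\<in>M. c m = 0))"
  unfolding alg_indep_rat_def exponents_def monomial_def subset_iff mem_Collect_eq by blast

lemma monomial_add: "monomial I (m + n) x = monomial I m x * monomial I n x"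
  by (simp add: monomial_def power_add prod.distrib)

lemma exponents_add: "m \<in> exponents I \<Longrightarrow> n \<in> exponents I \<Longrightarrow> m + n \<in> exponents I"
  by (simp add: exponents_def)

lemma rat_poly_funE:
  assumes "rat_poly_fun I f"
  obtains M c where "finite M" "M \<subseteq> exponents I"
    "f = (\<lambda>x. \<Sum>m\<in>M. of_rat (c m) * monomial I m x)"
  using assms unfolding rat_poly_fun_def by blast

lemma rat_poly_fun_term:
  assumes "m \<in> exponents I"
  shows "rat_poly_fun I (\<lambda>x. of_rat a * monomial I m x)"
  unfolding rat_poly_fun_def
  using assms by (intro exI[of _ "{m}"] exI[of _ "\<lambda>_. a"]) simp

lemma rat_poly_fun_const: "rat_poly_fun I (\<lambda>x. of_rat a)"
  using rat_poly_fun_term[of 0 I a] by (simp add: exponents_def monomial_def)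

lemma rat_poly_fun_var:
  fixes i :: 'b
  assumes "finite I" "i \<in> I"
  shows "rat_poly_fun I (\<lambda>x. x i :: 'k::field_char_0)"
proof -
  let ?m = "\<lambda>j. if j = i then 1 else 0"
  have "monomial I ?m = (\<lambda>x :: 'b \<Rightarrow> 'k. x i)"
    using assms
    by (simp add: fun_eq_iff monomial_def if_distrib[of "(^) _"] prod.delta cong: if_cong)
  moreover have "rat_poly_fun I (\<lambda>x :: 'b \<Rightarrow> 'k. of_rat 1 * monomial I ?m x)"
    using assms(2) by (intro rat_poly_fun_term) (auto simp: exponents_def)
  ultimately show ?thesis by simp
qed

lemma rat_poly_fun_add:
  assumes "rat_poly_fun I f" "rat_poly_fun I g"
  shows "rat_poly_fun I (\<lambda>x. f x + g x)"
proof -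
  from assms(1) obtain M c where M: "finite M" "M \<subseteq> exponents I"
    and f_eq: "f = (\<lambda>x. \<Sum>m\<in>M. of_rat (c m) * monomial I m x)" by (rule rat_poly_funE)
  from assms(2) obtain N d where N: "finite N" "N \<subseteq> exponents I"
    and g_eq: "g = (\<lambda>x. \<Sum>m\<in>N. of_rat (d m) * monomial I m x)" by (rule rat_poly_funE)
  let ?c = "\<lambda>m. if m \<in> M then c m else 0" and ?d = "\<lambda>m. if m \<in> N then d m else 0"
  have "f x = (\<Sum>m\<in>M \<union> N. of_rat (?c m) * monomial I m x)" for x
    unfolding f_eq using M(1) N(1) by (intro sum.mono_neutral_cong_left) auto
  moreover have "g x = (\<Sum>m\<in>M \<union> N. of_rat (?d m) * monomial I m x)" for x
    unfolding g_eq using M(1) N(1) by (intro sum.mono_neutral_cong_left) auto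
  ultimately have "(\<lambda>x. f x + g x) = (\<lambda>x. \<Sum>m\<in>M \<union> N. of_rat (?c m + ?d m) * monomial I m x)"
    by (simp add: of_rat_add distrib_right sum.distrib)
  then show ?thesis
    unfolding rat_poly_fun_def using M N
    by (intro exI[of _ "M \<union> N"] exI[of _ "\<lambda>m. ?c m + ?d m"]) simp
qed

lemma rat_poly_fun_sum:
  "(\<And>t. t \<in> T \<Longrightarrow> rat_poly_fun I (f t)) \<Longrightarrow> rat_poly_fun I (\<lambda>x. \<Sum>t\<in>T. f t x)"
  using rat_poly_fun_const[of I 0]
  by (induction T rule: infinite_finite_induct) (auto intro: rat_poly_fun_add)

lemma rat_poly_fun_mult:
  assumes "rat_poly_fun I f" "rat_poly_fun I g"
  shows "rat_poly_fun I (\<lambda>x. f x * g x)"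
proof -
  from assms(1) obtain M c where M: "finite M" "M \<subseteq> exponents I"
    and f_eq: "f = (\<lambda>x. \<Sum>m\<in>M. of_rat (c m) * monomial I m x)" by (rule rat_poly_funE)
  from assms(2) obtain N d where N: "finite N" "N \<subseteq> exponents I"
    and g_eq: "g = (\<lambda>x. \<Sum>n\<in>N. of_rat (d n) * monomial I n x)" by (rule rat_poly_funE)
  have "(\<lambda>x. f x * g x) =
      (\<lambda>x. \<Sum>m\<in>M. \<Sum>n\<in>N. of_rat (c m * d n) * monomial I (m + n) x)"
    unfolding f_eq g_eq by (simp add: sum_product of_rat_mult monomial_add mult_ac)
  moreover have "rat_poly_fun I (\<lambda>x. \<Sum>m\<in>M. \<Sum>n\<in>N. of_rat (c m * d n) * monomial I (m + n) x)"
    using M(2) N(2) by (intro rat_poly_fun_sum rat_poly_fun_term exponents_add) auto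
  ultimately show ?thesis by simp
qed

lemma rat_poly_fun_diff:
  assumes "rat_poly_fun I f" "rat_poly_fun I g"
  shows "rat_poly_fun I (\<lambda>x. f x - g x)"
  using rat_poly_fun_add[OF assms(1) rat_poly_fun_mult[OF rat_poly_fun_const assms(2)], of "-1"]
  by (simp add: of_rat_minus)

lemma rat_poly_fun_nonzero_at_alg_indep:
  assumes "rat_poly_fun I f" "alg_indep_rat I y" "f x \<noteq> 0"
  shows "f y \<noteq> 0"
proof
  assume "f y = 0"
  from assms(1) obtain M c where M: "finite M" "M \<subseteq> exponents I"
    and f_eq: "f = (\<lambda>x. \<Sum>m\<in>M. of_rat (c m) * monomial I m x)" by (rule rat_poly_funE)
  have "\<forall>m\<in>M. c m = 0"
    using assms(2) M f_eq \<open>f y = 0\<close> unfolding alg_indep_rat_iff by simp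
  then have "f x = 0" by (simp add: f_eq)
  with assms(3) show False by contradiction
qed

definition push_exponent :: "('b \<Rightarrow> 'c) \<Rightarrow> 'b set \<Rightarrow> ('b \<Rightarrow> nat) \<Rightarrow> 'c \<Rightarrow> nat" where
  "push_exponent g J m i = (if i \<in> g ` J then m (inv_into J g i) else 0)"

lemma push_exponent_apply:
  "inj_on g J \<Longrightarrow> j \<in> J \<Longrightarrow> push_exponent g J m (g j) = m j"
  by (simp add: push_exponent_def)

lemma inj_on_push_exponent:
  assumes "inj_on g J"
  shows "inj_on (push_exponent g J) (exponents J)"
proof (rule inj_onI, rule ext)
  fix m n j
  assume "m \<in> exponents J" "n \<in> exponents J" and "push_exponent g J m = push_exponent g J n"
  then show "m j = n j"
    using push_exponent_apply[OF assms, of j m] push_exponent_apply[OF assms, of j n]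
    by (cases "j \<in> J") (auto simp: exponents_def)
qed

lemma monomial_push_exponent:
  assumes "finite I" "inj_on g J" "g ` J \<subseteq> I"
  shows "monomial I (push_exponent g J m) x = monomial J m (x \<circ> g)"
proof -
  have "monomial I (push_exponent g J m) x = (\<Prod>i\<in>g ` J. x i ^ push_exponent g J m i)"
    unfolding monomial_def
    using assms(1,3) by (intro prod.mono_neutral_right) (auto simp: push_exponent_def)
  also have "\<dots> = monomial J m (x \<circ> g)"
    using assms(2) by (simp add: prod.reindex push_exponent_apply monomial_def)
  finally show ?thesis .
qed

lemma alg_indep_rat_reindex:
  assumes "alg_indep_rat I x" "finite I" "inj_on g J" "g ` J \<subseteq> I"
  shows "alg_indep_rat J (x \<circ> g)"
  unfolding alg_indep_rat_iff
proof (intro allI impI)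
  fix M c
  assume M: "finite M" "M \<subseteq> exponents J"
    and zero: "(\<Sum>m\<in>M. of_rat (c m) * monomial J m (x \<circ> g)) = 0"
  let ?push = "push_exponent g J"
  have inj: "inj_on ?push M"
    using inj_on_push_exponent[OF assms(3)] M(2) by (rule inj_on_subset)
  have "(\<Sum>n\<in>?push ` M. of_rat (c (inv_into M ?push n)) * monomial I n x) = 0"
    using zero by (simp add: sum.reindex[OF inj] inj monomial_push_exponent[OF assms(2-4)])
  moreover have "?push ` M \<subseteq> exponents I"
    using assms(4) by (auto simp: push_exponent_def exponents_def image_subset_iff)
  ultimately have "\<forall>n\<in>?push ` M. c (inv_into M ?push n) = 0"
    using assms(1) M(1) unfolding alg_indep_rat_iff
    by (elim allE[of _ "?push ` M"] allE[of _ "\<lambda>n. c (inv_into M ?push n)"]) simp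
  then show "\<forall>m\<in>M. c m = 0" by (simp add: inj)
qed

section \<open>Row dependencies of matrices\<close>

definition matrix_rows_indep :: "'r set \<Rightarrow> 'c set \<Rightarrow> ('r \<Rightarrow> 'c \<Rightarrow> 'k::field) \<Rightarrow> bool" where
  "matrix_rows_indep F K A \<longleftrightarrow>
     (\<forall>c. (\<forall>k\<in>K. (\<Sum>r\<in>F. c r * A r k) = 0) \<longrightarrow> (\<forall>r\<in>F. c r = 0))"

definition left_kernel :: "'r set \<Rightarrow> 'c set \<Rightarrow> ('r \<Rightarrow> 'c \<Rightarrow> 'k::field) \<Rightarrow> ('r \<Rightarrow> 'k) set" where
  "left_kernel E K A = {c. supp c \<subseteq> E \<and> (\<forall>k\<in>K. (\<Sum>r\<in>E. c r * A r k) = 0)}"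

lemma finite_support_space_left_kernel:
  assumes "finite E"
  shows "finite_support_space (left_kernel E K A)"
proof
  show "fun_space.subspace (left_kernel E K A)"
    by (rule fun_space.subspaceI)
      (auto simp: left_kernel_def supp_def subset_iff distrib_right sum.distrib mult.assoc
        simp flip: sum_distrib_left, metis add.right_neutral)
qed (use assms in \<open>auto simp: left_kernel_def intro: finite_subset\<close>)

lemma dependent_left_kernel_iff:
  assumes "finite E" "F \<subseteq> E"
  shows "dependent (left_kernel E K A) F \<longleftrightarrow> \<not> matrix_rows_indep F K A"
proof -
  have sum_eq: "(\<Sum>r\<in>E. c r * A r k) = (\<Sum>r\<in>F. c r * A r k)" if "supp c \<subseteq> F" for c k
    using assms that by (intro sum.mono_neutral_right) (auto simp: supp_def)
  show ?thesis
  proof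
    assume "dependent (left_kernel E K A) F"
    then obtain c where "c \<in> left_kernel E K A" and nonzero: "c \<noteq> 0" "supp c \<subseteq> F"
      unfolding dependent_def by blast
    then have "\<forall>k\<in>K. (\<Sum>r\<in>F. c r * A r k) = 0"
      by (simp add: left_kernel_def sum_eq)
    moreover have "\<exists>r\<in>F. c r \<noteq> 0"
      using nonzero by (auto simp: supp_def fun_eq_iff)
    ultimately show "\<not> matrix_rows_indep F K A"
      unfolding matrix_rows_indep_def by blast
  next
    assume "\<not> matrix_rows_indep F K A"
    then obtain c r where dependency: "\<forall>k\<in>K. (\<Sum>r\<in>F. c r * A r k) = 0"
      and "r \<in> F" "c r \<noteq> 0"
      unfolding matrix_rows_indep_def by blast
    let ?c = "indicator F * c"
    have supp: "supp ?c \<subseteq> F" by (simp add: supp_indicator_mult)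
    then have "(\<Sum>r\<in>E. ?c r * A r k) = (\<Sum>r\<in>F. c r * A r k)" for k
      by (subst sum_eq) (simp_all cong: sum.cong)
    then have "?c \<in> left_kernel E K A"
      using dependency assms(2) by (simp add: left_kernel_def subset_trans[OF supp])
    moreover have "?c \<noteq> 0"
      using \<open>r \<in> F\<close> \<open>c r \<noteq> 0\<close> by (auto dest: fun_cong[of _ _ r])
    ultimately show "dependent (left_kernel E K A) F"
      using supp unfolding dependent_def by blast
  qed
qed

definition eliminate_column :: "'r \<Rightarrow> 'c \<Rightarrow> ('r \<Rightarrow> 'c \<Rightarrow> 'k::field) \<Rightarrow> 'r \<Rightarrow> 'c \<Rightarrow> 'k" where
  "eliminate_column r k A s l = A r k * A s l - A s k * A r l"

lemma sum_eliminate_column: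
  assumes "finite F" "r \<notin> F"
  shows "(\<Sum>s\<in>F. c s * eliminate_column r k A s l) =
    A r k * (\<Sum>s\<in>insert r F. c s * A s l) - (\<Sum>s\<in>insert r F. c s * A s k) * A r l"
proof -
  have "(\<Sum>s\<in>F. c s * eliminate_column r k A s l) =
      A r k * (\<Sum>s\<in>F. c s * A s l) - (\<Sum>s\<in>F. c s * A s k) * A r l"
    by (simp add: eliminate_column_def sum_distrib_left sum_distrib_right
        sum_subtractf algebra_simps)
  with assms show ?thesis by (simp add: algebra_simps)
qed

lemma matrix_rows_indep_insert_iff:
  assumes F: "finite F" "r \<notin> F" and "k \<in> K" and pivot: "A r k \<noteq> 0"
  shows "matrix_rows_indep (insert r F) K A \<longleftrightarrow> matrix_rows_indep F K (eliminate_column r k A)"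
proof
  assume indep: "matrix_rows_indep (insert r F) K A"
  show "matrix_rows_indep F K (eliminate_column r k A)"
    unfolding matrix_rows_indep_def
  proof (intro allI impI)
    fix c assume dependency: "\<forall>l\<in>K. (\<Sum>s\<in>F. c s * eliminate_column r k A s l) = 0"
    define c' where "c' = c(r := - (\<Sum>s\<in>F. c s * A s k) / A r k)"
    have c'_on_F: "c' s = c s" if "s \<in> F" for s
      using that F(2) by (auto simp: c'_def)
    have "(\<Sum>s\<in>insert r F. c' s * A s k) = 0"
      using F pivot by (simp add: c'_on_F) (simp add: c'_def)
    then have "A r k * (\<Sum>s\<in>insert r F. c' s * A s l) = 0" if "l \<in> K" for l
      using sum_eliminate_column[OF F, of c' k A l] dependency that by (simp add: c'_on_F)
    then have "\<forall>s\<in>insert r F. c' s = 0"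
      using indep pivot unfolding matrix_rows_indep_def by simp
    then show "\<forall>s\<in>F. c s = 0" by (simp add: c'_on_F)
  qed
next
  assume indep: "matrix_rows_indep F K (eliminate_column r k A)"
  show "matrix_rows_indep (insert r F) K A"
    unfolding matrix_rows_indep_def
  proof (intro allI impI)
    fix c assume dependency: "\<forall>l\<in>K. (\<Sum>s\<in>insert r F. c s * A s l) = 0"
    have "(\<Sum>s\<in>F. c s * eliminate_column r k A s l) = 0" if "l \<in> K" for l
      using sum_eliminate_column[OF F, of c k A l] dependency \<open>k \<in> K\<close> that by simp
    then have F_zero: "\<forall>s\<in>F. c s = 0"
      using indep unfolding matrix_rows_indep_def by blast
    moreover have "c r * A r k = 0"
      using bspec[OF dependency \<open>k \<in> K\<close>] F F_zero by simp
    ultimately show "\<forall>s\<in>insert r F. c s = 0" using pivot by simp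
  qed
qed

lemma matrix_rows_indep_row_nonzero:
  assumes "matrix_rows_indep F K A" "r \<in> F"
  obtains k where "k \<in> K" "A r k \<noteq> 0"
proof -
  have "\<exists>k\<in>K. (\<Sum>s\<in>F. indicator {r} s * A s k) \<noteq> 0"
    using assms by (auto simp: matrix_rows_indep_def dest!: spec[of _ "indicator {r}"])
  then obtain k where "k \<in> K" "(\<Sum>s\<in>F. indicator {r} s * A s k) \<noteq> 0"
    by blast
  moreover from this(2) have "A r k \<noteq> 0"
    by (rule contrapos_nn) (auto intro: sum.neutral simp: indicator_def)
  ultimately show ?thesis using that by blast
qed

lemma matrix_rows_indep_at_alg_indep:
  fixes A :: "'r \<Rightarrow> 'c \<Rightarrow> ('b \<Rightarrow> real) \<Rightarrow> real"
  assumes "finite F" "\<And>r k. r \<in> F \<Longrightarrow> k \<in> K \<Longrightarrow> rat_poly_fun I (A r k)"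
    and "alg_indep_rat I y" "matrix_rows_indep F K (\<lambda>r k. A r k x)"
  shows "matrix_rows_indep F K (\<lambda>r k. A r k y)"
  using assms
proof (induction F arbitrary: A rule: finite_induct)
  case empty
  then show ?case by (simp add: matrix_rows_indep_def)
next
  case (insert r F)
  obtain k where k: "k \<in> K" "A r k x \<noteq> 0"
    using matrix_rows_indep_row_nonzero[OF insert.prems(3)] by blast
  then have pivot: "A r k y \<noteq> 0"
    using rat_poly_fun_nonzero_at_alg_indep insert.prems(1,2) by blast
  let ?B = "\<lambda>s l z. eliminate_column r k (\<lambda>s l. A s l z) s l"
  have "rat_poly_fun I (?B s l)" if "s \<in> F" "l \<in> K" for s l
    unfolding eliminate_column_def
    using that k(1) by (intro rat_poly_fun_diff rat_poly_fun_mult insert.prems(1)) auto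
  moreover have "matrix_rows_indep F K (\<lambda>s l. ?B s l x)"
    using matrix_rows_indep_insert_iff[OF insert.hyps k(1), of "\<lambda>s l. A s l x"]
      k(2) insert.prems(3) by simp
  ultimately have "matrix_rows_indep F K (\<lambda>s l. ?B s l y)"
    using insert.IH[of ?B] insert.prems(2) by simp
  then show ?case
    using matrix_rows_indep_insert_iff[OF insert.hyps k(1), of "\<lambda>s l. A s l y"] pivot by simp
qed

section \<open>Stresses of generic frameworks\<close>

definition rigidity_matrix ::
    "('a \<Rightarrow> nat \<Rightarrow> real) \<Rightarrow> 'a set \<Rightarrow> 'a \<times> nat \<Rightarrow> real" where
  "rigidity_matrix p e = (\<lambda>(w, j). rig_entry p e w j)"

definition stresses ::
    "'a set \<Rightarrow> 'a set set \<Rightarrow> nat \<Rightarrow> ('a \<Rightarrow> nat \<Rightarrow> real) \<Rightarrow> ('a set \<Rightarrow> real) set" where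
  "stresses V E k p = left_kernel E (V \<times> {..<k}) (rigidity_matrix p)"

lemma rows_indep_iff_matrix_rows_indep:
  "rows_indep V k p F \<longleftrightarrow> matrix_rows_indep F (V \<times> {..<k}) (rigidity_matrix p)"
  by (auto simp: rows_indep_def matrix_rows_indep_def rigidity_matrix_def)

lemma rat_poly_fun_rigidity_matrix:
  assumes "finite V" "e \<subseteq> V" "t \<in> V \<times> {..<k}"
  shows "rat_poly_fun (V \<times> {..<k}) (\<lambda>x. rigidity_matrix (curry x) e t)"
proof -
  obtain w j where t: "t = (w, j)" "w \<in> V" "j < k" using assms(3) by auto
  have "rat_poly_fun (V \<times> {..<k}) (\<lambda>x. \<Sum>v\<in>e - {w}. x (w, j) - x (v, j) :: real)"
    using t assms(1,2) by (intro rat_poly_fun_sum rat_poly_fun_diff rat_poly_fun_var) auto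
  then show ?thesis
    using rat_poly_fun_const[of "V \<times> {..<k}" 0]
    by (cases "w \<in> e") (simp_all add: rigidity_matrix_def t(1) rig_entry_def)
qed

lemma rig_indep_iff_rows_indep:
  assumes "finite V" "F \<subseteq> Pow V" "generic V k p"
  shows "rig_indep V k F \<longleftrightarrow> rows_indep V k p F"
proof
  assume "rig_indep V k F"
  then obtain q where "rows_indep V k q F" unfolding rig_indep_def by blast
  moreover have "finite F"
    using assms(1,2) by (simp add: finite_subset)
  moreover have "rat_poly_fun (V \<times> {..<k}) (\<lambda>x. rigidity_matrix (curry x) e t)"
    if "e \<in> F" "t \<in> V \<times> {..<k}" for e t
    using rat_poly_fun_rigidity_matrix assms(1,2) that by blast
  ultimately show "rows_indep V k p F"
    using matrix_rows_indep_at_alg_indep[of F "V \<times> {..<k}" "V \<times> {..<k}"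
        "\<lambda>e t x. rigidity_matrix (curry x) e t" "case_prod p" "case_prod q"] assms(3)
    by (simp add: rows_indep_iff_matrix_rows_indep generic_def)
qed (use assms(3) in \<open>auto simp: rig_indep_def\<close>)

lemma rig_circuit_iff_circuit:
  assumes "finite V" "E \<subseteq> Pow V" "generic V k p"
  shows "rig_circuit V E k C \<longleftrightarrow> circuit (stresses V E k p) C"
proof -
  have indep: "rig_indep V k F \<longleftrightarrow> \<not> dependent (stresses V E k p) F" if "F \<subseteq> E" for F
  proof -
    have "F \<subseteq> Pow V" using that assms(2) by blast
    moreover have "finite E" using assms(1,2) by (simp add: finite_subset)
    ultimately show ?thesis
      using that rig_indep_iff_rows_indep[OF assms(1) _ assms(3)]
      by (simp add: rows_indep_iff_matrix_rows_indep dependent_left_kernel_iff stresses_def)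
  qed
  have "C \<subseteq> E" if "circuit (stresses V E k p) C"
    using that by (auto simp: stresses_def left_kernel_def elim!: circuit_vector)
  then show ?thesis
    unfolding rig_circuit_def circuit_def
    by (metis indep psubset_imp_subset subset_trans)
qed

lemma M_connected_iff_matroid_connected:
  assumes "finite V" "E \<subseteq> Pow V" "generic V k p"
  shows "M_connected V E k \<longleftrightarrow> matroid_connected (stresses V E k p) E"
  by (simp add: M_connected_def matroid_connected_def rig_circuit_iff_circuit[OF assms])

lemma M_connected_imp_generic_exists:
  assumes "M_connected V E k" "e \<in> E" "f \<in> E" "e \<noteq> f"
  shows "\<exists>p. generic V k p"
proof -
  obtain C where "rig_circuit V E k C" "e \<in> C" "f \<in> C"
    using assms unfolding M_connected_def by blast
  then have "rig_indep V k {e}"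
    using assms(4) unfolding rig_circuit_def by blast
  then show ?thesis unfolding rig_indep_def by blast
qed

section \<open>Coordinate projections\<close>

definition coordinate_selections :: "nat \<Rightarrow> nat \<Rightarrow> (nat \<Rightarrow> nat) set" where
  "coordinate_selections m n = {\<sigma>. inj_on \<sigma> {..<m} \<and> \<sigma> ` {..<m} \<subseteq> {..<n}}"

lemma id_mem_coordinate_selections: "m \<le> n \<Longrightarrow> id \<in> coordinate_selections m n"
  by (auto simp: coordinate_selections_def)

lemma coordinate_selected:
  assumes "0 < m" "m \<le> n" "j < n"
  obtains \<sigma> where "\<sigma> \<in> coordinate_selections m n" "\<sigma> 0 = j"
proof
  show "transpose 0 j \<in> coordinate_selections m n"
    using assms by (auto simp: coordinate_selections_def transpose_def)
qed simp

definition select_coordinates ::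
    "(nat \<Rightarrow> nat) \<Rightarrow> ('a \<Rightarrow> nat \<Rightarrow> real) \<Rightarrow> 'a \<Rightarrow> nat \<Rightarrow> real" where
  "select_coordinates \<sigma> p = (\<lambda>v. p v \<circ> \<sigma>)"

lemma select_coordinates_id [simp]: "select_coordinates id p = p"
  by (simp add: select_coordinates_def)

lemma generic_select_coordinates:
  assumes "finite V" "generic V n p" "\<sigma> \<in> coordinate_selections m n"
  shows "generic V m (select_coordinates \<sigma> p)"
proof -
  have "alg_indep_rat (V \<times> {..<m}) (case_prod p \<circ> map_prod id \<sigma>)"
    using assms
    by (intro alg_indep_rat_reindex[where I = "V \<times> {..<n}"])
      (auto simp: generic_def coordinate_selections_def inj_on_def)
  moreover have "case_prod p \<circ> map_prod id \<sigma> = (\<lambda>(v, j). select_coordinates \<sigma> p v j)"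
    by (simp add: fun_eq_iff select_coordinates_def)
  ultimately show ?thesis by (simp add: generic_def)
qed

lemma stresses_eq_Inter_projections:
  assumes "0 < m" "m \<le> n"
  shows "stresses V E n p =
    (\<Inter>\<sigma>\<in>coordinate_selections m n. stresses V E m (select_coordinates \<sigma> p))"
proof -
  have entry: "rig_entry (select_coordinates \<sigma> p) e w j = rig_entry p e w (\<sigma> j)" for \<sigma> e w j
    by (simp add: rig_entry_def select_coordinates_def)
  show ?thesis
  proof (intro equalityI subsetI)
    fix c assume "c \<in> stresses V E n p"
    then show "c \<in> (\<Inter>\<sigma>\<in>coordinate_selections m n. stresses V E m (select_coordinates \<sigma> p))"
      by (auto simp: stresses_def left_kernel_def rigidity_matrix_def entry
          coordinate_selections_def)
  next
    fix c
    assume projections: "c \<in> (\<Inter>\<sigma>\<in>coordinate_selections m n. stresses V E m (select_coordinates \<sigma> p))"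
    have "(\<Sum>e\<in>E. c e * rig_entry p e w j) = 0" if "w \<in> V" "j < n" for w j
    proof -
      obtain \<sigma> where \<sigma>: "\<sigma> \<in> coordinate_selections m n" "\<sigma> 0 = j"
        using coordinate_selected assms \<open>j < n\<close> by blast
      then have "c \<in> stresses V E m (select_coordinates \<sigma> p)" using projections by blast
      then show ?thesis
        using \<open>w \<in> V\<close> assms(1) \<sigma>(2)
        by (auto simp: stresses_def left_kernel_def rigidity_matrix_def entry)
    qed
    moreover have "supp c \<subseteq> E"
      using projections id_mem_coordinate_selections[OF assms(2)]
      by (auto simp: stresses_def left_kernel_def)
    ultimately show "c \<in> stresses V E n p"
      by (auto simp: stresses_def left_kernel_def rigidity_matrix_def)
  qed
qed

lemma matroid_connected_stresses_projection:
  assumes VE: "finite V" "E \<subseteq> Pow V" and p: "generic V n p" and "0 < m" "m \<le> n"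
    and "matroid_connected (stresses V E n p) E" and \<sigma>: "\<sigma> \<in> coordinate_selections m n"
  shows "matroid_connected (stresses V E m (select_coordinates \<sigma> p)) E"
proof (rule matroid_connected_if_Inter
    [where S = "\<lambda>\<sigma>. stresses V E m (select_coordinates \<sigma> p)", OF _ _ _ \<sigma>])
  show "finite_support_space (stresses V E m (select_coordinates \<sigma> p))" for \<sigma>
    unfolding stresses_def using VE by (simp add: finite_support_space_left_kernel finite_subset)
next
  fix \<sigma> \<tau> C
  assume "\<sigma> \<in> coordinate_selections m n" "\<tau> \<in> coordinate_selections m n"
  then have "generic V m (select_coordinates \<sigma> p)" "generic V m (select_coordinates \<tau> p)"
    using generic_select_coordinates VE(1) p by blast+
  then show "circuit (stresses V E m (select_coordinates \<sigma> p)) C \<longleftrightarrow>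
      circuit (stresses V E m (select_coordinates \<tau> p)) C"
    by (simp flip: rig_circuit_iff_circuit[OF VE])
next
  show "matroid_connected
      (\<Inter>\<sigma>\<in>coordinate_selections m n. stresses V E m (select_coordinates \<sigma> p)) E"
    using assms(6) stresses_eq_Inter_projections[OF assms(4,5), of V E p] by simp
qed

theorem theorem5p1:
  fixes V :: "'a set" and E :: "'a set set" and d d' :: nat
  assumes "simple_graph V E"
    and "M_connected V E d"
    and "1 \<le> d'" and "d' \<le> d"
  shows "M_connected V E d'"
proof (cases "\<exists>e\<in>E. \<exists>f\<in>E. e \<noteq> f")
  case False
  then show ?thesis unfolding M_connected_def by blast
next
  case True
  with assms(2) obtain p where p: "generic V d p"
    using M_connected_imp_generic_exists by blast
  have VE: "finite V" "E \<subseteq> Pow V"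
    using assms(1) by (force simp: simple_graph_def)+
  have id: "id \<in> coordinate_selections d' d"
    using assms(4) by (rule id_mem_coordinate_selections)
  have "matroid_connected (stresses V E d p) E"
    using assms(2) M_connected_iff_matroid_connected[OF VE p] by simp
  then have "matroid_connected (stresses V E d' p) E"
    using matroid_connected_stresses_projection[OF VE p _ assms(4) _ id] assms(3) by simp
  moreover have "generic V d' p"
    using generic_select_coordinates[OF VE(1) p id] by simp
  ultimately show ?thesis
    using M_connected_iff_matroid_connected[OF VE] by blast
qed

end
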